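(* Let $J$ be one-homogeneous and let $u_\lambda$ be a singular vector of $J$ with corresponding singular value $\lambda$. Let the data be $f=\gamma Ku_\lambda+n$ with a positive constant $\gamma$ and noise $n\in\mathcal H$, such that there exist positive constants $\mu$ and $\eta$ with $$\mu K^*Ku_\lambda+\eta K^*n\in\partial J(u_\lambda)\qquad\text{and}\qquad \gamma>\frac{\mu}{\eta}.$$ Then a solution of the inverse scale space flow $$\partial_tp(t)=K^*(f-Ku(t)),\qquad p(t)\in\partial J(u(t)),\qquad p(0)=0,$$ on the time interval $[0,t_{**})$ is given by $$u(t)=\begin{cases}0 & \text{if } t<t_*,\\ c\,u_\lambda & \text{if } t_*\le t<t_{**},\end{cases}$$ for $$c=\gamma+\frac{\lambda-\mu}{\eta}\qquad\text{and}\qquad t_*=\frac{\lambda\eta}{\lambda+\gamma\eta-\mu}<t_{**}=\eta.$$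
   Context: Setting: $\mathcal U$ is a real Banach space that is the dual of some Banach space, $\mathcal H$ is a real Hilbert space, $K:\mathcal U\to\mathcal H$ is a bounded linear operator, and $J:\mathcal U\to\mathbb{R}\cup\{+\infty\}$ is proper, convex and non-negative, with $\mathrm{dom}(J)=\{u: J(u)<\infty\}$ and with non-empty subdifferential at every $u\in\mathrm{dom}(J)$. One-homogeneous means $J(cu)=|c|J(u)$ for all $c\in\mathbb{R}$, $u\in\mathcal U$ (with $0\cdot\infty=0$). $K^*:\mathcal H\to\mathcal U^*$ is the adjoint, $\langle K^*h,u\rangle_{\mathcal U}=\langle h,Ku\rangle_{\mathcal H}$. The subdifferential is $\partial J(u)=\{p\in\mathcal U^* : J(v)-J(u)-\langle p,v-u\rangle_{\mathcal U}\ge 0\ \forall v\in\mathcal U\}$. A singular vector of $J$ with singular value $\lambda$ is an element $u_\lambda\ne0$ with $\|Ku_\lambda\|_{\mathcal H}=1$ and $\lambda K^*Ku_\lambda\in\partial J(u_\lambda)$. That $u:[0,t_{**})\to\mathcal U$ is a solution of the inverse scale space flow on $[0,t_{**})$ means that there is a continuous $p:[0,t_{**})\to\mathcal U^*$ with $p(0)=0$, $p(t)\in\partial J(u(t))$ for all $t\in[0,t_{**})$, and $\partial_tp(t)=K^*(f-Ku(t))$ for all $t\in(0,t_{**})$ except the jump time of $u$. *)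

theory Defs
  imports "HOL-Analysis.Analysis"
begin

definition isometric_isomorphism ::
    "('a::real_normed_vector \<Rightarrow> 'b::real_normed_vector) \<Rightarrow> bool" where
  "isometric_isomorphism \<Phi> \<longleftrightarrow> linear \<Phi> \<and> (\<forall>x. norm (\<Phi> x) = norm x) \<and> surj \<Phi>"

text \<open>Functionals with values in the reals extended by plus infinity have type \<^typ>\<open>ereal\<close>;
  the value minus infinity is excluded by \<open>proper_functional\<close>.\<close>

definition effective_domain :: "('a \<Rightarrow> ereal) \<Rightarrow> 'a set" where
  "effective_domain J = {u. J u < \<infinity>}"

definition proper_functional :: "('a \<Rightarrow> ereal) \<Rightarrow> bool" where
  "proper_functional J \<longleftrightarrow> (\<forall>u. J u \<noteq> -\<infinity>) \<and> effective_domain J \<noteq> {}"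

definition convex_functional :: "('a::real_vector \<Rightarrow> ereal) \<Rightarrow> bool" where
  "convex_functional J \<longleftrightarrow>
     (\<forall>u v. \<forall>a\<in>{0..1}. J ((1 - a) *\<^sub>R u + a *\<^sub>R v) \<le> ereal (1 - a) * J u + ereal a * J v)"

text \<open>In \<^typ>\<open>ereal\<close>, zero times infinity is zero, so this forces \<open>J 0 = 0\<close>.\<close>

definition one_homogeneous :: "('a::real_vector \<Rightarrow> ereal) \<Rightarrow> bool" where
  "one_homogeneous J \<longleftrightarrow> (\<forall>c u. J (c *\<^sub>R u) = ereal \<bar>c\<bar> * J u)"

text \<open>For proper \<open>J\<close> this set is empty when \<open>J u = \<infinity>\<close>: any \<open>v\<close> in the effective domain makes
  the left-hand difference equal to minus infinity.  For \<open>J u < \<infinity>\<close> no term of the form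
  infinity minus infinity occurs.\<close>

definition subdifferential ::
    "('a::real_normed_vector \<Rightarrow> ereal) \<Rightarrow> 'a \<Rightarrow> ('a \<Rightarrow>\<^sub>L real) set" where
  "subdifferential J u = {p. \<forall>v. J v - J u - ereal (blinfun_apply p (v - u)) \<ge> 0}"

text \<open>The adjoint of \<open>K\<close> as a map from the Hilbert space itself (not its dual) into the dual
  of the domain of \<open>K\<close>.\<close>

definition dual_adjoint ::
    "('a::real_normed_vector \<Rightarrow>\<^sub>L 'h::real_inner) \<Rightarrow> 'h \<Rightarrow> ('a \<Rightarrow>\<^sub>L real)" where
  "dual_adjoint K h = blinfun_inner_right h o\<^sub>L K"

lemma dual_adjoint_apply: "blinfun_apply (dual_adjoint K h) u = h \<bullet> blinfun_apply K u"
  by (simp add: dual_adjoint_def blinfun_inner_right.rep_eq)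

definition singular_vector ::
    "('a::real_normed_vector \<Rightarrow>\<^sub>L 'h::real_inner) \<Rightarrow> ('a \<Rightarrow> ereal) \<Rightarrow> 'a \<Rightarrow> real \<Rightarrow> bool" where
  "singular_vector K J w lam \<longleftrightarrow>
     w \<noteq> 0 \<and> norm (blinfun_apply K w) = 1 \<and>
     lam *\<^sub>R dual_adjoint K (blinfun_apply K w) \<in> subdifferential J w"

definition jump_time :: "(real \<Rightarrow> 'a::topological_space) \<Rightarrow> real \<Rightarrow> bool" where
  "jump_time u t \<longleftrightarrow>
     (\<exists>l r. (u \<longlongrightarrow> l) (at_left t) \<and> (u \<longlongrightarrow> r) (at_right t) \<and> l \<noteq> r)"

text \<open>\<open>u\<close> solves the inverse scale space flow with data \<open>f\<close> on the half-open interval from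
  0 to \<open>T\<close>.  Only the values of \<open>u\<close> and \<open>p\<close> on that interval matter.  The time derivative
  is taken in the norm of the dual space.\<close>

definition iss_flow_solution ::
    "('a::real_normed_vector \<Rightarrow>\<^sub>L 'h::real_inner) \<Rightarrow> ('a \<Rightarrow> ereal) \<Rightarrow> 'h \<Rightarrow> real \<Rightarrow> (real \<Rightarrow> 'a) \<Rightarrow> bool"
  where
  "iss_flow_solution K J f T u \<longleftrightarrow>
     (\<exists>p :: real \<Rightarrow> ('a \<Rightarrow>\<^sub>L real).
        continuous_on {0..<T} p \<and>
        p 0 = 0 \<and>
        (\<forall>t\<in>{0..<T}. p t \<in> subdifferential J (u t)) \<and>
        (\<forall>t\<in>{0<..<T}. \<not> jump_time u t \<longrightarrow>
           (p has_vector_derivative dual_adjoint K (f - blinfun_apply K (u t))) (at t)))"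

end

theory Submission
  imports Defs
begin

text \<open>Write \<open>A = K\<^sup>* K u\<^sub>\<lambda>\<close> and \<open>B = K\<^sup>* n\<close>.  The subgradient path is
  \<open>p(t) = a(t) A + t B\<close>, where \<open>a\<close> is the minimum of the two affine functions \<open>\<gamma> t\<close> and
  \<open>\<lambda> + t (\<mu> - \<lambda>) / \<eta>\<close>, which cross exactly at \<open>t\<^sub>*\<close>.  Along the second branch \<open>p(t)\<close> is the
  convex combination of \<open>\<lambda> A\<close> and \<open>\<mu> A + \<eta> B\<close> with weight \<open>t / \<eta>\<close>, hence lies in
  \<open>\<partial>J(u\<^sub>\<lambda>) = \<partial>J(c u\<^sub>\<lambda>)\<close>; along the first branch it is \<open>(t / t\<^sub>*) p(t\<^sub>*)\<close>, which lies in
  \<open>\<partial>J(0)\<close> because \<open>\<partial>J(0)\<close> is star-shaped about 0 and contains \<open>\<partial>J(u\<^sub>\<lambda>)\<close>.\<close>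

lemma one_homogeneous_zero: "one_homogeneous J \<Longrightarrow> J 0 = 0"
  unfolding one_homogeneous_def by (metis abs_zero ereal_zero_mult scale_zero_left zero_ereal_def)

text \<open>Testing the subgradient inequality at \<open>0\<close> and at \<open>2u\<close> bounds
  \<open>J u\<close> by \<open>p u\<close> from both sides and rules out an infinite
  \<open>J u\<close>. With \<open>J u = p u\<close> inserted, the inequality at a general
  \<open>v\<close> loses its dependence on \<open>u\<close>.\<close>

lemma subdifferential_iff:
  fixes J :: "'a::real_normed_vector \<Rightarrow> ereal"
  assumes hom: "one_homogeneous J" and nonneg: "\<forall>u. J u \<ge> 0"
  shows "p \<in> subdifferential J u \<longleftrightarrow>
    J u = ereal (blinfun_apply p u) \<and> (\<forall>v. ereal (blinfun_apply p v) \<le> J v)"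
proof
  assume p: "p \<in> subdifferential J u"
  then have sub: "J v - J u - ereal (blinfun_apply p (v - u)) \<ge> 0" for v
    by (simp add: subdifferential_def)
  have J2: "J (2 *\<^sub>R u) = 2 * J u"
    using hom[unfolded one_homogeneous_def, rule_format, of 2 u] by simp
  have at0: "0 \<le> - J u - ereal (- blinfun_apply p u)"
    using sub[of 0] one_homogeneous_zero[OF hom] by (simp add: blinfun.minus_right)
  have at2: "0 \<le> 2 * J u - J u - ereal (blinfun_apply p u)"
    using sub[of "2 *\<^sub>R u"] J2 by (simp add: scaleR_2)
  have Ju: "J u = ereal (blinfun_apply p u)"
    using at0 at2 nonneg[rule_format, of u] by (cases "J u") auto
  moreover have "ereal (blinfun_apply p v) \<le> J v" for v
    using sub[of v] Ju nonneg[rule_format, of v]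
    by (cases "J v") (auto simp: blinfun.diff_right)
  ultimately show "J u = ereal (blinfun_apply p u) \<and> (\<forall>v. ereal (blinfun_apply p v) \<le> J v)"
    by blast
next
  assume *: "J u = ereal (blinfun_apply p u) \<and> (\<forall>v. ereal (blinfun_apply p v) \<le> J v)"
  have "J v - J u - ereal (blinfun_apply p (v - u)) \<ge> 0" for v
    using * nonneg[rule_format, of v] *[THEN conjunct2, rule_format, of v]
    by (cases "J v") (auto simp: blinfun.diff_right)
  then show "p \<in> subdifferential J u"
    by (simp add: subdifferential_def)
qed

text \<open>Both sides of \<open>J u = p u\<close> scale by \<open>c\<close>, and the other
  condition of \<open>subdifferential_iff\<close> does not mention \<open>u\<close>. The case
  \<open>c = 0\<close> embeds every subdifferential into that at \<open>0\<close>.\<close>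

lemma subdifferential_scaleR:
  fixes J :: "'a::real_normed_vector \<Rightarrow> ereal"
  assumes "one_homogeneous J" and "\<forall>u. J u \<ge> 0"
    and "p \<in> subdifferential J u" and "0 \<le> c"
  shows "p \<in> subdifferential J (c *\<^sub>R u)"
  using assms by (auto simp: subdifferential_iff one_homogeneous_def blinfun.scaleR_right)

lemma subdifferential_convex:
  fixes J :: "'a::real_normed_vector \<Rightarrow> ereal"
  assumes "one_homogeneous J" and "\<forall>u. J u \<ge> 0"
  shows "convex (subdifferential J u)"
proof (rule convexI)
  fix p q and a b :: real
  assume pq: "p \<in> subdifferential J u" "q \<in> subdifferential J u"
    and ab: "0 \<le> a" "0 \<le> b" "a + b = 1"
  have p: "J u = ereal (blinfun_apply p u)" "\<And>v. ereal (blinfun_apply p v) \<le> J v"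
    and q: "J u = ereal (blinfun_apply q u)" "\<And>v. ereal (blinfun_apply q v) \<le> J v"
    using pq by (simp_all add: subdifferential_iff[OF assms])
  have "blinfun_apply q u = blinfun_apply p u"
    using p(1) q(1) by simp
  then have "blinfun_apply (a *\<^sub>R p + b *\<^sub>R q) u = blinfun_apply p u"
    using ab by (simp add: blinfun.add_left blinfun.scaleR_left flip: distrib_right)
  moreover have "ereal (blinfun_apply (a *\<^sub>R p + b *\<^sub>R q) v) \<le> J v" for v
  proof (cases "J v")
    case (real r)
    then have "blinfun_apply p v \<le> r" "blinfun_apply q v \<le> r"
      using p(2)[of v] q(2)[of v] by simp_all
    then show ?thesis
      using real ab convex_bound_le[of "blinfun_apply p v" r "blinfun_apply q v" a b]
      by (simp add: blinfun.add_left blinfun.scaleR_left)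
  qed (use assms(2)[rule_format, of v] in auto)
  ultimately show "a *\<^sub>R p + b *\<^sub>R q \<in> subdifferential J u"
    using p(1) by (simp add: subdifferential_iff[OF assms])
qed

lemma zero_in_subdifferential_zero:
  fixes J :: "'a::real_normed_vector \<Rightarrow> ereal"
  assumes "one_homogeneous J" and "\<forall>u. J u \<ge> 0"
  shows "0 \<in> subdifferential J 0"
  using assms(2) by (simp add: subdifferential_iff[OF assms] one_homogeneous_zero[OF assms(1)]
      flip: zero_ereal_def)

text \<open>The flow equation is waived only at jump times, so the switching time of the solution
  has to be recognised as one.\<close>

lemma jump_time_step:
  fixes a b :: "'a::t2_space"
  assumes "a \<noteq> b"
  shows "jump_time (\<lambda>t. if t < s then a else b) s"
proof -
  have "((\<lambda>t. if t < s then a else b) \<longlongrightarrow> a) (at_left s)"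
    by (rule tendsto_eventually) (simp add: eventually_at_filter)
  moreover have "((\<lambda>t. if t < s then a else b) \<longlongrightarrow> b) (at_right s)"
    by (rule tendsto_eventually) (simp add: eventually_at_filter)
  ultimately show ?thesis
    using assms unfolding jump_time_def by blast
qed

theorem theorem10:
  fixes \<Phi> :: "'u::banach \<Rightarrow> ('v::banach \<Rightarrow>\<^sub>L real)"
    and K :: "'u \<Rightarrow>\<^sub>L 'h::{real_inner, complete_space}"
    and J :: "'u \<Rightarrow> ereal"
    and w :: 'u
    and f n :: 'h
    and lam \<gamma> \<mu> \<eta> c t1 t2 :: real
  assumes "isometric_isomorphism \<Phi>"
    and "proper_functional J"
    and "convex_functional J"
    and "\<forall>u. J u \<ge> 0"
    and "\<forall>u\<in>effective_domain J. subdifferential J u \<noteq> {}"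
    and "one_homogeneous J"
    and "singular_vector K J w lam"
    and "\<gamma> > 0"
    and "f = \<gamma> *\<^sub>R blinfun_apply K w + n"
    and "\<mu> > 0"
    and "\<eta> > 0"
    and "\<mu> *\<^sub>R dual_adjoint K (blinfun_apply K w) + \<eta> *\<^sub>R dual_adjoint K n \<in> subdifferential J w"
    and "\<gamma> > \<mu> / \<eta>"
    and "c = \<gamma> + (lam - \<mu>) / \<eta>"
    and "t1 = lam * \<eta> / (lam + \<gamma> * \<eta> - \<mu>)"
    and "t2 = \<eta>"
  shows "t1 < t2 \<and>
    iss_flow_solution K J f t2 (\<lambda>t. if t < t1 then 0 else c *\<^sub>R w)"
proof -
  note hom = assms(6) and nonneg = assms(4)
  define A where "A = dual_adjoint K (blinfun_apply K w)"
  define B where "B = dual_adjoint K n"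
  \<comment> \<open>Taking a minimum instead of a case distinction at \<open>t1\<close> makes the
    continuity of \<open>p\<close> immediate.\<close>
  define a where "a t = min (\<gamma> * t) (lam + t * (\<mu> - lam) / \<eta>)" for t
  define p where "p t = a t *\<^sub>R A + t *\<^sub>R B" for t
  have w: "w \<noteq> 0" "norm (blinfun_apply K w) = 1" "lam *\<^sub>R A \<in> subdifferential J w"
    using assms(7) by (simp_all add: singular_vector_def A_def)
  have AB: "\<mu> *\<^sub>R A + \<eta> *\<^sub>R B \<in> subdifferential J w"
    using assms(12) by (simp add: A_def B_def)
  \<comment> \<open>Pairing \<open>A\<close> with \<open>w\<close> gives the squared norm of
    \<open>K w\<close>, which is 1.\<close>
  have "J w = ereal lam"
    using w by (simp add: subdifferential_iff[OF hom nonneg] A_def blinfun.scaleR_left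
        dual_adjoint_apply dot_square_norm)
  then have lam: "lam \<ge> 0"
    using nonneg[rule_format, of w] by simp
  have gap: "\<gamma> * \<eta> - \<mu> > 0"
    using assms(11,13) by (simp add: field_simps)
  define D where "D = lam + \<gamma> * \<eta> - \<mu>"
  have D: "D > 0" "t1 = lam * \<eta> / D" "c = D / \<eta>"
    using gap lam assms(11,14,15) by (simp_all add: D_def field_simps)
  have c: "c > 0"
    using D assms(11) by simp
  have t1_nonneg: "t1 \<ge> 0"
    using D lam assms(11) by simp
  have t1_less: "t1 < \<eta>"
  proof -
    have "lam * \<eta> < D * \<eta>"
      using assms(11) gap by (intro mult_strict_right_mono) (simp_all add: D_def)
    then show ?thesis
      using D by (simp add: pos_divide_less_eq mult.commute)
  qed
  \<comment> \<open>The difference of the two branches has slope \<open>-c\<close> and vanishes at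
    \<open>t1\<close>; as \<open>c > 0\<close>, its sign decides which branch is the
    minimum.\<close>
  have branches: "lam + t * (\<mu> - lam) / \<eta> - \<gamma> * t = (t1 - t) * c" for t
  proof -
    have "t1 * c = lam"
      using D assms(11) by simp
    moreover have "t * c = \<gamma> * t - t * (\<mu> - lam) / \<eta>"
      using assms(11) by (simp add: assms(14) field_simps)
    ultimately show ?thesis
      by (simp add: left_diff_distrib)
  qed
  have a_before: "a t = \<gamma> * t" if "t \<le> t1" for t
  proof -
    have "(t1 - t) * c \<ge> 0"
      using that c by simp
    then show ?thesis
      unfolding a_def branches[of t, symmetric] by linarith
  qed
  have a_after: "a t = lam + t * (\<mu> - lam) / \<eta>" if "t1 \<le> t" for t
  proof -
    have "(t1 - t) * c \<le> 0"
      using that c by (simp add: mult_le_0_iff)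
    then show ?thesis
      unfolding a_def branches[of t, symmetric] by linarith
  qed
  have sub_after: "p t \<in> subdifferential J w" if "t1 \<le> t" "t < \<eta>" for t
  proof -
    have "p t = (1 - t / \<eta>) *\<^sub>R (lam *\<^sub>R A) + (t / \<eta>) *\<^sub>R (\<mu> *\<^sub>R A + \<eta> *\<^sub>R B)"
    proof -
      have "a t = (1 - t / \<eta>) * lam + t / \<eta> * \<mu>"
        using a_after[OF that(1)] assms(11) by (simp add: field_simps)
      then show ?thesis
        using assms(11) by (simp add: p_def scaleR_add_right scaleR_add_left)
    qed
    then show ?thesis
      using convexD[OF subdifferential_convex[OF hom nonneg] w(3) AB, of "1 - t / \<eta>" "t / \<eta>"]
        that t1_nonneg assms(11) by simp
  qed
  have sub_before: "p t \<in> subdifferential J 0" if "0 \<le> t" "t < t1" for t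
  proof -
    \<comment> \<open>Scaling \<open>w\<close> by 0 carries the subgradient at \<open>w\<close> over
      to \<open>0\<close>.\<close>
    have "p t1 \<in> subdifferential J 0"
      using subdifferential_scaleR[OF hom nonneg sub_after[of t1], of 0] t1_less by simp
    then have "(t / t1) *\<^sub>R p t1 \<in> subdifferential J 0"
      using convexD[OF subdifferential_convex[OF hom nonneg]
          zero_in_subdifferential_zero[OF hom nonneg], of "p t1" "1 - t / t1" "t / t1"] that by simp
    \<comment> \<open>Both branches are available at \<open>t1\<close>, so
      \<open>a t1 = \<gamma> * t1\<close> as well; here \<open>t1 > 0\<close> because
      \<open>0 \<le> t < t1\<close>.\<close>
    moreover have "(t / t1) *\<^sub>R p t1 = p t"
      using that by (simp add: p_def a_before scaleR_add_right)
    ultimately show ?thesis by simp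
  qed
  let ?u = "\<lambda>t. if t < t1 then 0 else c *\<^sub>R w"
  have adjoint: "dual_adjoint K (s *\<^sub>R blinfun_apply K w + n) = s *\<^sub>R A + B" for s
    by (rule blinfun_eqI)
      (simp add: A_def B_def dual_adjoint_apply blinfun.add_left blinfun.scaleR_left inner_add_left)
  have deriv: "(p has_vector_derivative dual_adjoint K (f - blinfun_apply K (?u t))) (at t)"
    if "t \<noteq> t1" for t
  proof (cases "t < t1")
    case True
    have "((\<lambda>t. (\<gamma> * t) *\<^sub>R A + t *\<^sub>R B) has_vector_derivative \<gamma> *\<^sub>R A + B) (at t)"
      by (auto intro!: derivative_eq_intros
          simp flip: has_real_derivative_iff_has_vector_derivative)
    then have "(p has_vector_derivative \<gamma> *\<^sub>R A + B) (at t)"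
      by (rule has_vector_derivative_transform_within_open[of _ _ _ "{..<t1}"])
        (use True in \<open>simp_all add: p_def a_before\<close>)
    then show ?thesis
      using True by (simp add: assms(9) adjoint)
  next
    case False
    with that have t: "t > t1" by simp
    have "((\<lambda>t. (lam + t * (\<mu> - lam) / \<eta>) *\<^sub>R A + t *\<^sub>R B) has_vector_derivative
        ((\<mu> - lam) / \<eta>) *\<^sub>R A + B) (at t)"
      using assms(11)
      by (auto intro!: derivative_eq_intros
          simp flip: has_real_derivative_iff_has_vector_derivative)
    then have "(p has_vector_derivative ((\<mu> - lam) / \<eta>) *\<^sub>R A + B) (at t)"
      by (rule has_vector_derivative_transform_within_open[of _ _ _ "{t1<..}"])
        (use t in \<open>simp_all add: p_def a_after\<close>)
    \<comment> \<open>This is what determines \<open>c\<close>: the coefficient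
      \<open>\<gamma> - c\<close> left in the residual has to equal the slope of the second
      branch.\<close>
    moreover have "f - blinfun_apply K (c *\<^sub>R w) = ((\<mu> - lam) / \<eta>) *\<^sub>R blinfun_apply K w + n"
    proof -
      have "(\<mu> - lam) / \<eta> = \<gamma> - c"
        by (simp add: assms(14) diff_divide_distrib)
      then show ?thesis
        by (simp add: assms(9) blinfun.scaleR_right scaleR_diff_left)
    qed
    ultimately show ?thesis
      using False by (simp add: adjoint)
  qed
  have "continuous_on {0..<t2} p"
    unfolding p_def a_def by (intro continuous_intros) (use assms(11) in auto)
  moreover have "p 0 = 0"
    using a_before[of 0] t1_nonneg by (simp add: p_def)
  moreover have "p t \<in> subdifferential J (?u t)" if "t \<in> {0..<t2}" for t
    using that sub_before[of t] subdifferential_scaleR[OF hom nonneg sub_after[of t], of c] c assms(16)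
    by simp
  \<comment> \<open>Since \<open>c > 0\<close> and \<open>w\<close> is nonzero, \<open>t1\<close> is
    a genuine jump, and the kink of \<open>p\<close> there is harmless.\<close>
  moreover have "t \<noteq> t1" if "\<not> jump_time ?u t" for t
    using that jump_time_step[of 0 "c *\<^sub>R w" t1] w c by auto
  ultimately have "iss_flow_solution K J f t2 ?u"
    unfolding iss_flow_solution_def by (intro exI[of _ p] conjI ballI impI deriv)
  then show ?thesis
    using t1_less assms(16) by simp
qed

end
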